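(* For $1\le p\le\infty$, the operator ideal $(\mathcal K_p,\kappa_p)$ of $p$-compact operators is surjective.
   Context: For a Banach space $E$ and $1\le p<\infty$, $\ell_p(E)$ is the space of sequences $(x_n)_n$ in $E$ with $\|(x_n)_n\|_p=(\sum_n\|x_n\|^p)^{1/p}<\infty$; for $p=\infty$ it is replaced by $c_0(E)$ with the supremum norm. With $\frac1p+\frac1{p'}=1$, for $(x_n)_n\in\ell_p(E)$ put $p\text{-}\mathrm{co}\{x_n\}=\{\sum_{n=1}^\infty\alpha_nx_n:(\alpha_n)_n\in B_{\ell_{p'}}\}$, where $\ell_{p'}$ is replaced by $c_0$ if $p=1$. A bounded operator $T\colon E\to F$ is $p$-compact, $T\in\mathcal K_p(E;F)$, if $T(B_E)\subset p\text{-}\mathrm{co}\{x_n\}$ for some $(x_n)_n\in\ell_p(F)$, and $\kappa_p(T)=\inf\{\|(x_n)_n\|_p: T(B_E)\subset p\text{-}\mathrm{co}\{x_n\}\}$. A Banach operator ideal $(\mathcal A,\|\cdot\|_{\mathcal A})$ is surjective if for all Banach spaces $E,F,G$, every metric surjection (quotient map) $Q\colon G\to E$ and every bounded operator $T\colon E\to F$: $TQ\in\mathcal A(G;F)$ implies $T\in\mathcal A(E;F)$ and $\|T\|_{\mathcal A}=\|TQ\|_{\mathcal A}$. *)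

theory Defs
  imports "HOL-Analysis.Analysis"
begin

text \<open>
  Up to isometric isomorphism the only instances of \<^class>\<open>real_normed_field\<close> are \<^typ>\<open>real\<close> and
  \<^typ>\<open>complex\<close>, so a type variable of this class ranges over the admissible scalar fields. A Banach
  space over it is a type of class \<^class>\<open>banach\<close>, which supplies addition and the complete norm,
  together with a scalar multiplication for which the norm is homogeneous. Additivity and
  continuity force this multiplication to extend \<^const>\<open>scaleR\<close>.
\<close>

locale banach_space = vector_space scale
  for scale :: "'k::real_normed_field \<Rightarrow> 'a::banach \<Rightarrow> 'a" +
  assumes norm_scale: "norm (scale c x) = norm c * norm x"

lemma banach_space_scaleR: "banach_space (scaleR :: real \<Rightarrow> 'a::banach \<Rightarrow> 'a)"
  by unfold_locales (simp_all add: scaleR_add_right scaleR_add_left)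

lemma banach_space_mult: "banach_space (times :: complex \<Rightarrow> complex \<Rightarrow> complex)"
  by unfold_locales (simp_all add: algebra_simps norm_mult)

definition bounded_operator ::
  "('k::real_normed_field \<Rightarrow> 'a::banach \<Rightarrow> 'a) \<Rightarrow> ('k \<Rightarrow> 'b::banach \<Rightarrow> 'b) \<Rightarrow> ('a \<Rightarrow> 'b) \<Rightarrow> bool"
  where "bounded_operator sE sF T \<longleftrightarrow>
    Vector_Spaces.linear sE sF T \<and> (\<exists>C. \<forall>x. norm (T x) \<le> C * norm x)"

definition metric_surjection ::
  "('k::real_normed_field \<Rightarrow> 'a::banach \<Rightarrow> 'a) \<Rightarrow> ('k \<Rightarrow> 'b::banach \<Rightarrow> 'b) \<Rightarrow> ('a \<Rightarrow> 'b) \<Rightarrow> bool"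
  where "metric_surjection sG sE Q \<longleftrightarrow>
    bounded_operator sG sE Q \<and> surj Q \<and> (\<forall>x. norm x = (INF g\<in>{g. Q g = x}. norm g))"

text \<open>
  For \<open>p = \<infinity>\<close> the space is \<open>c\<^sub>0\<close>, not \<open>\<ell>\<^sub>\<infinity>\<close>, both for vector-valued sequences and for scalar ones;
  the latter occurs when \<open>p = 1\<close>, as then the conjugate exponent is \<open>\<infinity>\<close>.
\<close>

definition ell :: "ennreal \<Rightarrow> (nat \<Rightarrow> 'a::real_normed_vector) set"
  where "ell p =
    (if p = \<infinity> then {x. x \<longlonglongrightarrow> 0}
     else {x. summable (\<lambda>n. norm (x n) powr enn2real p)})"

definition ell_norm :: "ennreal \<Rightarrow> (nat \<Rightarrow> 'a::real_normed_vector) \<Rightarrow> real"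
  where "ell_norm p x =
    (if p = \<infinity> then (SUP n. norm (x n))
     else (\<Sum>n. norm (x n) powr enn2real p) powr (1 / enn2real p))"

definition conj_exponent :: "ennreal \<Rightarrow> ennreal"
  where "conj_exponent p = inverse (1 - inverse p)"

lemma conj_exponent:
  assumes "1 \<le> p"
  shows "1 / p + 1 / conj_exponent p = 1"
proof -
  have le: "inverse p \<le> 1"
  proof (cases p)
    case (real r)
    then show ?thesis
      using assms by (simp add: inverse_ennreal field_simps)
  qed simp
  have inv: "inverse (inverse q) = q" for q :: ennreal
    by (cases q; cases "q = 0") (simp_all add: inverse_ennreal)
  show ?thesis
    using le by (simp add: conj_exponent_def divide_ennreal_def inv)
qed

definition p_co ::
  "('k::real_normed_field \<Rightarrow> 'a::banach \<Rightarrow> 'a) \<Rightarrow> ennreal \<Rightarrow> (nat \<Rightarrow> 'a) \<Rightarrow> 'a set"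
  where "p_co sF p x =
    {y. \<exists>\<alpha>. \<alpha> \<in> ell (conj_exponent p) \<and> ell_norm (conj_exponent p) \<alpha> \<le> 1 \<and>
            (\<lambda>n. sF (\<alpha> n) (x n)) sums y}"

definition p_compact_ops ::
  "('k::real_normed_field \<Rightarrow> 'a::banach \<Rightarrow> 'a) \<Rightarrow> ('k \<Rightarrow> 'b::banach \<Rightarrow> 'b) \<Rightarrow> ennreal \<Rightarrow> ('a \<Rightarrow> 'b) set"
  where "p_compact_ops sE sF p =
    {T. bounded_operator sE sF T \<and> (\<exists>x\<in>ell p. T ` cball 0 1 \<subseteq> p_co sF p x)}"

definition kappa ::
  "('k::real_normed_field \<Rightarrow> 'b::banach \<Rightarrow> 'b) \<Rightarrow> ennreal \<Rightarrow> ('a::banach \<Rightarrow> 'b) \<Rightarrow> real"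
  where "kappa sF p T = Inf {ell_norm p x | x. x \<in> ell p \<and> T ` cball 0 1 \<subseteq> p_co sF p x}"

end

theory Submission
  imports Defs
begin

text \<open>
  A metric surjection maps the closed unit ball into the closed unit ball and onto the open one.
  Hence \<open>(T \<circ> Q) (B\<^sub>G) \<subseteq> p-co {x\<^sub>n}\<close> only gives \<open>T (y) \<in> p-co {x\<^sub>n}\<close> for \<open>\<parallel>y\<parallel> < 1\<close>,
  and \<open>p-co {x\<^sub>n}\<close> need not be closed when \<open>p = 1\<close>. Dilating by \<open>c > 1\<close> repairs this for every
  \<open>p\<close> at once: \<open>T (B\<^sub>E) \<subseteq> p-co {c x\<^sub>n}\<close>, and letting \<open>c\<close> tend to 1 costs nothing in the infimum.
\<close>

lemma norm_metric_surjection_le: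
  assumes "metric_surjection sG sE Q"
  shows "norm (Q g) \<le> norm g"
proof -
  have "norm (Q g) = (INF h\<in>{h. Q h = Q g}. norm h)"
    using assms by (simp add: metric_surjection_def)
  also have "\<dots> \<le> norm g"
    by (rule cINF_lower) (auto intro: bdd_belowI2[where m = 0])
  finally show ?thesis .
qed

text \<open>An infimum strictly below \<open>r\<close> is undercut by some member of the set. The
  quotient norm need not be attained, so the bound on the lift must leave room above
  \<open>norm x\<close>.\<close>

lemma metric_surjection_lift:
  assumes "metric_surjection sG sE Q" and "norm x < r"
  obtains g where "Q g = x" and "norm g < r"
proof -
  have "(INF g\<in>{g. Q g = x}. norm g) < r" and "{g. Q g = x} \<noteq> {}"
    using assms by (auto simp: metric_surjection_def surj_def) metis
  moreover have "bdd_below (norm ` {g. Q g = x})"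
    by (auto intro: bdd_belowI2[where m = 0])
  ultimately show ?thesis
    using that by (auto simp: cINF_less_iff)
qed

lemma bdd_above_norm_ell_infinity:
  assumes "x \<in> ell \<infinity>"
  shows "bdd_above (range (\<lambda>n. norm (x n)))"
proof -
  have "convergent x"
    using assms by (auto simp: ell_def convergent_def)
  then obtain K where "norm (x n) \<le> K" for n
    using convergent_imp_Bseq BseqE by metis
  then show ?thesis
    by (intro bdd_aboveI2)
qed

text \<open>This makes 0 a lower bound of the set whose infimum is \<open>kappa\<close>. For p =
  \<infinity> the supremum dominates \<open>norm (x 0)\<close> because null sequences are
  bounded.\<close>

lemma ell_norm_nonneg:
  assumes "x \<in> ell p"
  shows "0 \<le> ell_norm p x"
proof (cases "p = \<infinity>")
  case True
  then have "bdd_above (range (\<lambda>n. norm (x n)))"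
    using assms by (intro bdd_above_norm_ell_infinity) simp
  then have "norm (x 0) \<le> (SUP n. norm (x n))"
    by (rule cSUP_upper[rotated]) simp
  then show ?thesis
    using True norm_ge_zero[of "x 0"] by (simp add: ell_norm_def del: norm_ge_zero)
qed (simp add: ell_norm_def)

lemma kappa_le:
  assumes "x \<in> ell p" and "T ` cball 0 1 \<subseteq> p_co sF p x"
  shows "kappa sF p T \<le> ell_norm p x"
  unfolding kappa_def using assms
  by (intro cInf_lower bdd_belowI[where m = 0]) (auto intro: ell_norm_nonneg)

context banach_space
begin

text \<open>Continuity of \<open>scale c\<close> is not an axiom of \<open>banach_space\<close> but
  follows from homogeneity: \<open>scale c (f n)\<close> and \<open>scale c l\<close> differ by
  \<open>norm c * norm (f n - l)\<close> in norm.\<close>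

lemma tendsto_scale:
  assumes "(f \<longlongrightarrow> l) F"
  shows "((\<lambda>n. scale c (f n)) \<longlongrightarrow> scale c l) F"
proof -
  have "((\<lambda>n. norm c * norm (f n - l)) \<longlongrightarrow> norm c * 0) F"
    using assms by (intro tendsto_intros) (simp add: LIM_zero tendsto_norm_zero)
  then have "((\<lambda>n. norm (scale c (f n) - scale c l)) \<longlongrightarrow> 0) F"
    by (simp add: norm_scale flip: scale_right_diff_distrib)
  then show ?thesis
    by (simp add: LIM_zero_cancel tendsto_norm_zero_iff)
qed

lemma sums_scale: "f sums l \<Longrightarrow> (\<lambda>n. scale c (f n)) sums scale c l"
  unfolding sums_def by (simp add: tendsto_scale flip: scale_sum_right)

lemma ell_scale:
  assumes "x \<in> ell p"
  shows "(\<lambda>n. scale c (x n)) \<in> ell p"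
  using assms tendsto_scale[of x 0 sequentially c]
  by (auto simp: ell_def norm_scale powr_mult intro: summable_mult)

lemma ell_norm_scale_le:
  assumes "1 \<le> p" and "x \<in> ell p"
  shows "ell_norm p (\<lambda>n. scale c (x n)) \<le> norm c * ell_norm p x"
proof (cases "p = \<infinity>")
  case True
  then have "bdd_above (range (\<lambda>n. norm (x n)))"
    using assms by (intro bdd_above_norm_ell_infinity) simp
  then show ?thesis
    using True by (auto simp: ell_norm_def norm_scale
        intro!: cSUP_least mult_left_mono cSUP_upper)
next
  case False
  \<comment> \<open>Since 1 \<le> p < \<infinity>, the exponent is nonzero, so the outer power 1/p
    turns the factor \<open>norm c powr enn2real p\<close> back into \<open>norm c\<close>.\<close>
  then have "enn2real p \<noteq> 0" and "summable (\<lambda>n. norm (x n) powr enn2real p)"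
    using assms by (cases p; simp add: ell_def)+
  then show ?thesis
    using False by (simp add: ell_norm_def norm_scale powr_mult suminf_mult suminf_nonneg powr_powr)
qed

text \<open>Scalars commute, so \<open>c\<close> can be absorbed into the vectors. The same
  coefficients \<open>\<alpha>\<close> serve and stay in the unit ball.\<close>

lemma scale_mem_p_co:
  assumes "y \<in> p_co scale p x"
  shows "scale c y \<in> p_co scale p (\<lambda>n. scale c (x n))"
proof -
  obtain \<alpha> where "\<alpha> \<in> ell (conj_exponent p)" "ell_norm (conj_exponent p) \<alpha> \<le> 1"
    and y: "(\<lambda>n. scale (\<alpha> n) (x n)) sums y"
    using assms by (auto simp: p_co_def)
  moreover have "(\<lambda>n. scale (\<alpha> n) (scale c (x n))) sums scale c y"
    using sums_scale[OF y, of c] by (simp add: mult.commute)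
  ultimately show ?thesis
    by (auto simp: p_co_def)
qed

end

theorem proposition3p1:
  fixes p :: ennreal
    and sE :: "'k::real_normed_field \<Rightarrow> 'e::banach \<Rightarrow> 'e"
    and sF :: "'k \<Rightarrow> 'f::banach \<Rightarrow> 'f"
    and sG :: "'k \<Rightarrow> 'g::banach \<Rightarrow> 'g"
    and Q :: "'g \<Rightarrow> 'e" and T :: "'e \<Rightarrow> 'f"
  assumes "1 \<le> p"
    and "banach_space sE" and "banach_space sF" and "banach_space sG"
    and "metric_surjection sG sE Q"
    and "bounded_operator sE sF T"
    and "T \<circ> Q \<in> p_compact_ops sG sF p"
  shows "T \<in> p_compact_ops sE sF p \<and> kappa sF p T = kappa sF p (T \<circ> Q)"
proof -
  interpret E: banach_space sE by fact
  interpret F: banach_space sF by fact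
  interpret T: Vector_Spaces.linear sE sF T
    using assms(6) by (simp add: bounded_operator_def)
  have dilate: "T ` cball 0 1 \<subseteq> p_co sF p (\<lambda>n. sF (of_real c) (x n))"
    if x: "(T \<circ> Q) ` cball 0 1 \<subseteq> p_co sF p x" and c: "1 < c" for x c
  proof
    fix z assume "z \<in> T ` cball 0 1"
    then obtain y where y: "norm y \<le> 1" "z = T y" by auto
    \<comment> \<open>Dividing by c > 1 puts the point into the open unit ball, where a lift in the
      unit ball of the domain of \<open>Q\<close> exists. The real \<open>c\<close> enters as the
      scalar \<open>of_real c\<close>, of norm \<open>c\<close>.\<close>
    define y' where "y' = sE (inverse (of_real c)) y"
    have "norm y' < 1"
      using c y by (simp add: y'_def E.norm_scale norm_inverse flip: divide_inverse_commute)
    then obtain g where g: "Q g = y'" "norm g < 1"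
      by (rule metric_surjection_lift[OF assms(5)])
    then have "(T \<circ> Q) g \<in> p_co sF p x"
      using x by (intro subsetD[OF x] imageI) simp
    then have "sF (of_real c) (T y') \<in> p_co sF p (\<lambda>n. sF (of_real c) (x n))"
      using g by (simp add: F.scale_mem_p_co)
    moreover have "sF (of_real c) (T y') = z"
      using c y by (simp add: y'_def T.scale)
    ultimately show "z \<in> p_co sF p (\<lambda>n. sF (of_real c) (x n))" by simp
  qed
  have restrict: "(T \<circ> Q) ` cball 0 1 \<subseteq> p_co sF p x" if "T ` cball 0 1 \<subseteq> p_co sF p x" for x
  proof -
    have "Q ` cball 0 1 \<subseteq> cball 0 1"
      using norm_metric_surjection_le[OF assms(5)] order_trans by fastforce
    with that show ?thesis
      unfolding image_comp[symmetric] by blast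
  qed
  obtain x where x: "x \<in> ell p" "(T \<circ> Q) ` cball 0 1 \<subseteq> p_co sF p x"
    using assms(7) by (auto simp: p_compact_ops_def)
  have "\<exists>x\<in>ell p. T ` cball 0 1 \<subseteq> p_co sF p x"
    \<comment> \<open>The value 2 is arbitrary: membership needs just one dilation factor above
      1.\<close>
    using dilate[OF x(2), of 2] F.ell_scale[OF x(1)] by auto
  moreover have "kappa sF p T \<le> kappa sF p (T \<circ> Q)"
    unfolding kappa_def[of sF p "T \<circ> Q"]
  proof (rule cInf_greatest)
    show "{ell_norm p x |x. x \<in> ell p \<and> (T \<circ> Q) ` cball 0 1 \<subseteq> p_co sF p x} \<noteq> {}"
      using x by blast
  next
    fix r assume "r \<in> {ell_norm p x |x. x \<in> ell p \<and> (T \<circ> Q) ` cball 0 1 \<subseteq> p_co sF p x}"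
    then obtain w where w: "w \<in> ell p" "(T \<circ> Q) ` cball 0 1 \<subseteq> p_co sF p w"
      and r: "r = ell_norm p w" by blast
    have le: "kappa sF p T \<le> c * r" if "1 < c" for c
    proof -
      have "kappa sF p T \<le> ell_norm p (\<lambda>n. sF (of_real c) (w n))"
        by (intro kappa_le F.ell_scale w dilate that)
      also have "\<dots> \<le> c * r"
        using F.ell_norm_scale_le[OF assms(1) w(1), of "of_real c"] that by (simp add: r)
      finally show ?thesis .
    qed
    \<comment> \<open>The bound \<open>le\<close> is available for c > 1, hence the limit from the
      right; \<open>w\<close> itself need not be admissible for \<open>T\<close>.\<close>
    have "((\<lambda>c. c * r) \<longlongrightarrow> 1 * r) (at_right 1)"
      by (intro tendsto_intros)
    then have "kappa sF p T \<le> 1 * r"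
      by (rule tendsto_lowerbound) (auto simp: eventually_at_filter le)
    then show "kappa sF p T \<le> r" by simp
  qed
  moreover have "kappa sF p (T \<circ> Q) \<le> kappa sF p T"
    unfolding kappa_def[of sF p T]
    \<comment> \<open>The membership part comes first because it makes the set of norms for
      \<open>T\<close> nonempty, as \<open>cInf_greatest\<close> requires. By
      \<open>restrict\<close>, every sequence admissible for \<open>T\<close> is admissible for
      \<open>T \<circ> Q\<close>.\<close>
    using calculation(1) by (intro cInf_greatest) (auto intro!: kappa_le restrict)
  ultimately show ?thesis
    using assms(6) by (auto simp: p_compact_ops_def)
qed

end
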